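(* For every integer $n\ge 1$, let $$\mathcal{K}_n := \{A\subset \{1,\ldots,n\} : \text{either } A=\emptyset \text{ or } (\max A - 1\in A \text{ and } \min A\ge |A|)\}.$$ Then $|\mathcal{K}_n| = F_n$ for all $n\ge 1$, where $(F_n)$ is the Fibonacci sequence defined by $F_1=F_2=1$ and $F_n=F_{n-1}+F_{n-2}$ for $n\ge 3$.
   Context: $|A|$ denotes the cardinality of a finite set $A$. *)

theory Defs
  imports "HOL-Number_Theory.Fib"
begin

(* Max and Min are only consulted for nonempty finite A with all elements >= 1,
   so they are the true extrema and the natural-number subtraction does not truncate. *)
definition K_family :: "nat \<Rightarrow> nat set set" where
  "K_family n = {A. A \<subseteq> {1..n} \<and> (A = {} \<or> (Max A - 1 \<in> A \<and> Min A \<ge> card A))}"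

end

theory Submission
  imports Defs
begin

text \<open>A member of the family with maximum \<open>n\<close> is \<open>{n - 1, n} \<union> B\<close> with
  \<open>B \<subseteq> {1..n - 2}\<close> and all elements of \<open>B\<close> at least \<open>|B| + 2\<close>.  The number of such \<open>B\<close> is
  \<open>F_(n-2)\<close>: according to whether \<open>m\<close> is in \<open>B\<close>, the sets inside \<open>{1..m}\<close> either lie in
  \<open>{1..m - 1}\<close>, or lose \<open>m\<close> and, shifted down by one, lie in \<open>{1..m - 2}\<close>.  Hence
  \<open>|K_n| - |K_(n-1)| = F_(n-2)\<close>.\<close>

text \<open>Bounding every element, instead of \<open>Min B\<close>, admits the empty set without a
  separate case.\<close>

definition sparse_family :: "nat \<Rightarrow> nat set set" where
  "sparse_family m = {B. B \<subseteq> {1..m} \<and> (\<forall>b\<in>B. card B + 2 \<le> b)}"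

lemma finite_sparse_family: "finite (sparse_family m)"
  by (rule finite_subset[of _ "Pow {1..m}"]) (auto simp: sparse_family_def)

lemma finite_mem_sparse_family: "B \<in> sparse_family m \<Longrightarrow> finite B"
  by (auto simp: sparse_family_def intro: finite_subset)

lemma finite_K_family: "finite (K_family n)"
  by (rule finite_subset[of _ "Pow {1..n}"]) (auto simp: K_family_def)

text \<open>A nonempty member has cardinality at least 1, so its elements are at least 3.\<close>

lemma sparse_family_small:
  assumes "m \<le> 2" shows "sparse_family m = {{}}"
proof -
  have "B = {}" if "B \<in> sparse_family m" for B
  proof (rule ccontr)
    assume "B \<noteq> {}"
    then obtain b where b: "b \<in> B" by blast
    have "card B > 0"
      using finite_mem_sparse_family[OF that] \<open>B \<noteq> {}\<close> by (simp add: card_gt_0_iff)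
    moreover have "b \<le> m" "card B + 2 \<le> b"
      using that b by (auto simp: sparse_family_def)
    ultimately show False using assms by linarith
  qed
  then show ?thesis by (auto simp: sparse_family_def)
qed

text \<open>Removing \<open>m + 2\<close> lowers the cardinality, and so the required lower bound,
  by one; this is exactly what the shift by \<open>Suc\<close> absorbs.\<close>

lemma sparse_family_containing_max:
  assumes "m \<ge> 1"
  shows "{B \<in> sparse_family (m + 2). m + 2 \<in> B} = (\<lambda>C. insert (m + 2) (Suc ` C)) ` sparse_family m"
    (is "?L = ?f ` _")
proof (intro equalityI subsetI)
  fix B assume "B \<in> ?L"
  then have B: "B \<in> sparse_family (m + 2)" and mB: "m + 2 \<in> B" by auto
  have fin: "finite B" using B by (rule finite_mem_sparse_family)
  define C where "C = Suc -` (B - {m + 2})"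
  have low: "card B + 2 \<le> b" and up: "b \<le> m + 2" if "b \<in> B" for b
    using B that by (auto simp: sparse_family_def)
  have SucC: "Suc ` C = B - {m + 2}"
  proof -
    \<comment> \<open>No element of \<open>B\<close> is 0, so taking the preimage under
      \<open>Suc\<close> loses nothing.\<close>
    have "b \<in> range Suc" if "b \<in> B" for b
      using low[OF that] by (cases b) auto
    then show ?thesis by (auto simp: C_def)
  qed
  have cardB: "card B = card C + 1"
    using SucC fin mB by (metis Suc_eq_plus1 card_Suc_Diff1 card_image inj_Suc)
  have "C \<subseteq> {1..m}" "\<forall>c\<in>C. card C + 2 \<le> c"
    using low up cardB by (fastforce simp: C_def)+
  then have "C \<in> sparse_family m" by (simp add: sparse_family_def)
  moreover have "B = ?f C" using SucC mB by auto
  ultimately show "B \<in> ?f ` sparse_family m" by blast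
next
  fix B assume "B \<in> ?f ` sparse_family m"
  then obtain C where C: "C \<in> sparse_family m" and B: "B = ?f C" by auto
  have fin: "finite C" using C by (rule finite_mem_sparse_family)
  have C1: "C \<subseteq> {1..m}" and C2: "\<And>c. c \<in> C \<Longrightarrow> card C + 2 \<le> c"
    using C by (auto simp: sparse_family_def)
  have "m + 2 \<notin> Suc ` C" using C1 by auto
  then have cardB: "card B = card C + 1" using B fin by (simp add: card_image)
  \<comment> \<open>This is the bound that the new element \<open>m + 2\<close> must satisfy itself.
    For empty \<open>C\<close> it is the assumption on \<open>m\<close>; otherwise any element of
    \<open>C\<close> lies between \<open>card C + 2\<close> and \<open>m\<close>.\<close>
  have "card C + 1 \<le> m"
  proof (cases "C = {}")
    case False
    then obtain c where "c \<in> C" by blast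
    with C1 C2[of c] show ?thesis by force
  qed (use assms in simp)
  then show "B \<in> ?L"
    using B C1 C2 cardB by (fastforce simp: sparse_family_def)
qed

lemma card_sparse_family_rec:
  assumes "m \<ge> 1"
  shows "card (sparse_family (m + 2)) = card (sparse_family (m + 1)) + card (sparse_family m)"
proof -
  let ?f = "\<lambda>C. insert (m + 2) (Suc ` C)"
  have "inj_on ?f (sparse_family m)"
  proof (rule inj_on_inverseI)
    fix C assume "C \<in> sparse_family m"
    then show "Suc -` (?f C - {m + 2}) = C"
      by (auto simp: sparse_family_def)
  qed
  then have "card {B \<in> sparse_family (m + 2). m + 2 \<in> B} = card (sparse_family m)"
    by (simp only: sparse_family_containing_max[OF assms] card_image)
  \<comment> \<open>The bound on the elements does not mention \<open>m\<close>, so only the ambient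
    interval distinguishes the two families.\<close>
  moreover have "B \<subseteq> {1..m + 1} \<longleftrightarrow> B \<subseteq> {1..m + 2} \<and> m + 2 \<notin> B" for B :: "nat set"
    by (auto simp: le_Suc_eq subset_iff)
  then have "{B \<in> sparse_family (m + 2). m + 2 \<notin> B} = sparse_family (m + 1)"
    unfolding sparse_family_def by blast
  moreover have "sparse_family (m + 2) =
      {B \<in> sparse_family (m + 2). m + 2 \<notin> B} \<union> {B \<in> sparse_family (m + 2). m + 2 \<in> B}"
    by blast
  then have "card (sparse_family (m + 2)) = card {B \<in> sparse_family (m + 2). m + 2 \<notin> B}
      + card {B \<in> sparse_family (m + 2). m + 2 \<in> B}"
    using finite_sparse_family[of "m + 2"] by (subst card_Un_disjoint[symmetric]) auto
  ultimately show ?thesis by simp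
qed

text \<open>The index starts at 1 because \<open>sparse_family 0\<close> has one member while
  \<open>fib 0 = 0\<close>.\<close>

lemma card_sparse_family: "card (sparse_family (Suc m)) = fib (Suc m)"
proof (induction m rule: fib.induct)
  case (3 m)
  then show ?case using card_sparse_family_rec[of "Suc m"] by simp
qed (simp_all add: sparse_family_small)

text \<open>A nonempty member would have to contain both 1 and 2, giving minimum 1 but cardinality
  2.\<close>

lemma K_family_small:
  assumes "n \<le> 2" shows "K_family n = {{}}"
proof -
  have "A = {}" if "A \<in> K_family n" for A
  proof (rule ccontr)
    assume ne: "A \<noteq> {}"
    have sub: "A \<subseteq> {1..n}" and M: "Max A - 1 \<in> A" and card: "card A \<le> Min A"
      using that ne by (auto simp: K_family_def)
    have fin: "finite A" using sub by (rule finite_subset) simp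
    have "Max A \<in> A" using fin ne by simp
    then have "Max A \<in> {1..n}" "Max A - 1 \<in> {1..n}" using sub M by blast+
    with assms have "Max A = 2" unfolding atLeastAtMost_iff by linarith
    with M \<open>Max A \<in> A\<close> have "{1, 2} \<subseteq> A" by simp
    then have "card {1, 2 :: nat} \<le> card A" "Min A \<le> 1"
      using fin by (auto intro: card_mono simp del: card_insert_disjoint)
    with card show False by simp
  qed
  then show ?thesis by (auto simp: K_family_def)
qed

text \<open>The maximum \<open>m + 3\<close> forces \<open>m + 2\<close> into the set. These two
  elements account for the 2 in the bound \<open>card B + 2\<close> on the remaining ones.\<close>

lemma K_family_containing_max:
  "{A \<in> K_family (m + 3). m + 3 \<in> A} = (\<lambda>B. {m + 2, m + 3} \<union> B) ` sparse_family (m + 1)"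
    (is "?L = ?f ` _")
proof (intro equalityI subsetI)
  fix A assume "A \<in> ?L"
  then have sub: "A \<subseteq> {1..m + 3}" and mA: "m + 3 \<in> A" and M: "Max A - 1 \<in> A"
    and card: "card A \<le> Min A"
    by (auto simp: K_family_def)
  have fin: "finite A" using sub by (rule finite_subset) simp
  have "Max A = m + 3" using sub mA fin by (intro Max_eqI) auto
  with M have mA': "m + 2 \<in> A" by simp
  define B where "B = A - {m + 2, m + 3}"
  have A: "A = ?f B" using mA mA' by (auto simp: B_def)
  have "finite B" "m + 2 \<notin> B" "m + 3 \<notin> B" using fin by (simp_all add: B_def)
  then have cardA: "card A = card B + 2" unfolding A by simp
  have "B \<subseteq> {1..m + 1}"
  proof
    fix b assume "b \<in> B"
    then have "b \<in> {1..m + 3}" "b \<noteq> m + 2" "b \<noteq> m + 3" using sub by (auto simp: B_def)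
    then show "b \<in> {1..m + 1}" by simp
  qed
  moreover have "card B + 2 \<le> b" if "b \<in> B" for b
  proof -
    have "Min A \<le> b" using fin that A by (intro Min_le) auto
    with card cardA show ?thesis by linarith
  qed
  ultimately have "B \<in> sparse_family (m + 1)" by (simp add: sparse_family_def)
  with A show "A \<in> ?f ` sparse_family (m + 1)" by blast
next
  fix A assume "A \<in> ?f ` sparse_family (m + 1)"
  then obtain B where B: "B \<in> sparse_family (m + 1)" and A: "A = ?f B" by blast
  have finB: "finite B" using B by (rule finite_mem_sparse_family)
  have B1: "B \<subseteq> {1..m + 1}" and B2: "\<And>b. b \<in> B \<Longrightarrow> card B + 2 \<le> b"
    using B by (auto simp: sparse_family_def)
  have "m + 2 \<notin> B" "m + 3 \<notin> B" using B1 by auto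
  then have cardA: "card A = card B + 2" using A finB by simp
  \<comment> \<open>Equivalent to \<open>card A \<le> m + 2\<close>, so that the two adjoined
    elements also respect the bound on the minimum.\<close>
  have "card B \<le> m"
  proof (cases "B = {}")
    case False
    then obtain b where "b \<in> B" by blast
    with B1 B2[of b] show ?thesis by force
  qed simp
  then have "card A \<le> a" if "a \<in> A" for a
    using that A B2 cardA by auto
  then have "card A \<le> Min A" using A finB by (intro Min.boundedI) auto
  moreover have "Max A = m + 3" using A finB B1 by (intro Max_eqI) auto
  moreover have "A \<subseteq> {1..m + 3}" using A B1 by auto
  ultimately show "A \<in> ?L" using A by (simp add: K_family_def)
qed

lemma card_K_family_rec:
  "card (K_family (m + 3)) = card (K_family (m + 2)) + card (sparse_family (m + 1))"
proof -
  let ?f = "\<lambda>B. {m + 2, m + 3} \<union> B"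
  have "inj_on ?f (sparse_family (m + 1))"
  proof (rule inj_on_inverseI)
    fix B assume "B \<in> sparse_family (m + 1)"
    then show "?f B - {m + 2, m + 3} = B"
      by (auto simp: sparse_family_def)
  qed
  then have "card {A \<in> K_family (m + 3). m + 3 \<in> A} = card (sparse_family (m + 1))"
    by (simp only: K_family_containing_max card_image)
  \<comment> \<open>Again the conditions on \<open>Max\<close> and \<open>Min\<close> do not involve
    the ambient interval.\<close>
  moreover have "A \<subseteq> {1..m + 2} \<longleftrightarrow> A \<subseteq> {1..m + 3} \<and> m + 3 \<notin> A" for A :: "nat set"
    by (auto simp: le_Suc_eq subset_iff numeral_3_eq_3)
  then have "{A \<in> K_family (m + 3). m + 3 \<notin> A} = K_family (m + 2)"
    unfolding K_family_def by blast
  moreover have "K_family (m + 3) =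
      {A \<in> K_family (m + 3). m + 3 \<notin> A} \<union> {A \<in> K_family (m + 3). m + 3 \<in> A}"
    by blast
  then have "card (K_family (m + 3)) = card {A \<in> K_family (m + 3). m + 3 \<notin> A}
      + card {A \<in> K_family (m + 3). m + 3 \<in> A}"
    using finite_K_family[of "m + 3"] by (subst card_Un_disjoint[symmetric]) auto
  ultimately show ?thesis by simp
qed

theorem theorem1:
  fixes n :: nat
  assumes "n \<ge> 1"
  shows "card (K_family n) = fib n"
  using assms
proof (induction n rule: dec_induct)
  case base
  show ?case by (simp add: K_family_small)
next
  case (step n)
  show ?case
  \<comment> \<open>The recursion first applies to \<open>K_family 3\<close>, so
    \<open>K_family 2\<close> is evaluated directly.\<close>
  proof (cases "n = 1")
    case True
    then show ?thesis by (simp add: K_family_small)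
  next
    case False
    with step.hyps have "\<exists>m. n = m + 2" by presburger
    then obtain m where "n = m + 2" ..
    then show ?thesis
      using card_K_family_rec[of m] card_sparse_family[of m] step.IH
      by (simp add: numeral_3_eq_3)
  qed
qed

end
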